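(* Let $X$ be a graph on $n$ vertices whose number of spanning trees is a power of two. Let $u,v$ be vertices of $X$ and let $\lambda\neq 0$ be an integer Laplacian eigenvalue of $X$. If $\lambda\in\Lambda_{uv}^-$, then $\lambda$ is a power of two.
   Context: Graphs are finite, simple and undirected. For a graph $X$ with adjacency matrix $A$ and diagonal degree matrix $D$, the Laplacian matrix is $L=D-A$, with spectral decomposition $L=\sum_{r=0}^d \lambda_r F_r$, where $\lambda_0<\dots<\lambda_d$ are the distinct eigenvalues and $F_r$ is the orthogonal projection onto the $\lambda_r$-eigenspace. For a vertex $u$, $\mathbf{e}_u$ is its characteristic vector; $\Lambda_u=\{\lambda_r : F_r\mathbf{e}_u\neq 0\}$ and $\Lambda_{uv}^-=\{\lambda_r\in\Lambda_u : F_r\mathbf{e}_u=-F_r\mathbf{e}_v\}$. Powers of two include $2^0=1$. *)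

theory Defs
  imports "HOL-Analysis.Analysis"
begin

text \<open>A graph has a finite type \<open>'v\<close> as its vertex set and is given by its edge set.\<close>

definition simple_graph :: "'v::finite set set \<Rightarrow> bool" where
  "simple_graph E \<longleftrightarrow> (\<forall>e\<in>E. card e = 2)"

definition graph_connected :: "'v::finite set set \<Rightarrow> bool" where
  "graph_connected E \<longleftrightarrow> (\<forall>u v. (u, v) \<in> {(x, y). {x, y} \<in> E}\<^sup>*)"

definition graph_cycle :: "'v::finite set set \<Rightarrow> 'v list \<Rightarrow> bool" where
  "graph_cycle E p \<longleftrightarrow> 3 \<le> length p \<and> distinct p \<and>
     (\<forall>i<length p. {p ! i, p ! (Suc i mod length p)} \<in> E)"

definition spanning_tree :: "'v::finite set set \<Rightarrow> 'v set set \<Rightarrow> bool" where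
  "spanning_tree E T \<longleftrightarrow> T \<subseteq> E \<and> graph_connected T \<and> (\<nexists>p. graph_cycle T p)"

definition num_spanning_trees :: "'v::finite set set \<Rightarrow> nat" where
  "num_spanning_trees E = card {T. spanning_tree E T}"

definition adjacency_matrix :: "'v::finite set set \<Rightarrow> real^'v^'v" where
  "adjacency_matrix E = (\<chi> i j. if {i, j} \<in> E then 1 else 0)"

definition vertex_degree :: "'v::finite set set \<Rightarrow> 'v \<Rightarrow> nat" where
  "vertex_degree E v = card {e \<in> E. v \<in> e}"

definition degree_matrix :: "'v::finite set set \<Rightarrow> real^'v^'v" where
  "degree_matrix E = (\<chi> i j. if i = j then real (vertex_degree E i) else 0)"

definition laplacian_matrix :: "'v::finite set set \<Rightarrow> real^'v^'v" where
  "laplacian_matrix E = degree_matrix E - adjacency_matrix E"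

definition laplacian_eigenspace :: "'v::finite set set \<Rightarrow> real \<Rightarrow> (real^'v) set" where
  "laplacian_eigenspace E \<theta> = {x. laplacian_matrix E *v x = \<theta> *\<^sub>R x}"

definition laplacian_eigenvalue :: "'v::finite set set \<Rightarrow> real \<Rightarrow> bool" where
  "laplacian_eigenvalue E \<theta> \<longleftrightarrow> (\<exists>x. x \<noteq> 0 \<and> laplacian_matrix E *v x = \<theta> *\<^sub>R x)"

definition orthogonal_projection :: "'a::euclidean_space set \<Rightarrow> 'a \<Rightarrow> 'a" where
  "orthogonal_projection S x = (THE y. y \<in> S \<and> (\<forall>z\<in>S. orthogonal (x - y) z))"

lemma orthogonal_projection_unique:
  fixes S :: "'a::euclidean_space set"
  assumes "subspace S"
  shows "\<exists>!y. y \<in> S \<and> (\<forall>z\<in>S. orthogonal (x - y) z)"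
proof (rule ex_ex1I)
  obtain y z where "y \<in> span S" "\<And>w. w \<in> span S \<Longrightarrow> orthogonal z w" "x = y + z"
    using orthogonal_subspace_decomp_exists by blast
  moreover have "span S = S"
    using assms by (simp add: span_eq_iff)
  ultimately show "\<exists>y. y \<in> S \<and> (\<forall>z\<in>S. orthogonal (x - y) z)"
    by (metis add_diff_cancel_left')
next
  fix y y'
  assume y: "y \<in> S \<and> (\<forall>z\<in>S. orthogonal (x - y) z)"
    and y': "y' \<in> S \<and> (\<forall>z\<in>S. orthogonal (x - y') z)"
  have "y - y' \<in> S"
    using assms y y' by (simp add: subspace_diff)
  then have "(x - y') \<bullet> (y - y') = 0" "(x - y) \<bullet> (y - y') = 0"
    using y y' by (auto simp: orthogonal_def)
  then have "(y - y') \<bullet> (y - y') = 0"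
    by (simp add: inner_diff_left)
  then show "y = y'"
    by simp
qed

lemma subspace_laplacian_eigenspace: "subspace (laplacian_eigenspace E \<theta>)"
  by (simp add: laplacian_eigenspace_def subspace_def matrix_vector_right_distrib
      scaleR_right_distrib matrix_vector_mult_scaleR)

text \<open>For an eigenvalue \<open>\<theta> = \<lambda>\<^sub>r\<close>, this is \<open>F\<^sub>r\<close> as a linear map; \<open>e\<^sub>u\<close> is \<open>axis u 1\<close>.\<close>

definition laplacian_proj :: "'v::finite set set \<Rightarrow> real \<Rightarrow> real^'v \<Rightarrow> real^'v" where
  "laplacian_proj E \<theta> = orthogonal_projection (laplacian_eigenspace E \<theta>)"

definition eigenvalue_support :: "'v::finite set set \<Rightarrow> 'v \<Rightarrow> real set" where
  "eigenvalue_support E u =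
     {\<theta>. laplacian_eigenvalue E \<theta> \<and> laplacian_proj E \<theta> (axis u 1) \<noteq> 0}"

definition eigenvalue_support_minus :: "'v::finite set set \<Rightarrow> 'v \<Rightarrow> 'v \<Rightarrow> real set" where
  "eigenvalue_support_minus E u v =
     {\<theta> \<in> eigenvalue_support E u.
        laplacian_proj E \<theta> (axis u 1) = - laplacian_proj E \<theta> (axis v 1)}"

end

theory Submission
  imports Defs
begin

text \<open>
  Kirchhoff's double counting shows that a Laplacian kernel vector modulo a prime \<open>p\<close> not dividing
  the number \<open>\<tau>\<close> of spanning trees is constant, without determinants: for an integer function \<open>x\<close>
  and vertices \<open>s, r\<close>, telescope \<open>x s - x r\<close> along the \<open>s\<close>-\<open>r\<close> path of every spanning tree \<open>T\<close>.
  Grouping the pairs of a tree and a path edge \<open>e\<close> by the forest \<open>T - e\<close>, each forest \<open>F\<close>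
  contributes the sum of \<open>x a - x b\<close> over all edges of the graph leaving the component of \<open>s\<close>
  in \<open>F\<close>, that is, the sum of \<open>L x\<close> over this component. Hence \<open>\<tau> (x s - x r)\<close> is a sum of
  values of \<open>L x\<close>.

  If an odd prime \<open>p\<close> divides the eigenvalue, apply this to a primitive integer eigenvector \<open>y\<close>:
  it is a nonzero constant modulo \<open>p\<close>, but \<open>y u = - y v\<close>.
\<close>

section \<open>Reachability, components and bridges\<close>

definition reach :: "'v set set \<Rightarrow> ('v \<times> 'v) set" where
  "reach F = {(x, y). {x, y} \<in> F}\<^sup>*"

definition component :: "'v set set \<Rightarrow> 'v \<Rightarrow> 'v set" where
  "component F s = {w. (s, w) \<in> reach F}"

text \<open>Stands in for acyclicity in terms of reachability alone, so that exchanging edges needs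
  no vertex lists. A loop \<open>{a, a}\<close> violates it, because \<open>reach\<close> is
  reflexive.\<close>

definition all_bridges :: "'v set set \<Rightarrow> bool" where
  "all_bridges T \<longleftrightarrow> (\<forall>a b. {a, b} \<in> T \<longrightarrow> (a, b) \<notin> reach (T - {{a, b}}))"

lemma graph_connected_iff_reach: "graph_connected T \<longleftrightarrow> (\<forall>u v. (u, v) \<in> reach T)"
  by (simp add: graph_connected_def reach_def)

lemma reach_refl [simp]: "(x, x) \<in> reach F"
  by (simp add: reach_def)

lemma reach_edge: "{a, b} \<in> F \<Longrightarrow> (a, b) \<in> reach F"
  unfolding reach_def by (rule r_into_rtrancl) simp

lemma reach_trans: "(x, y) \<in> reach F \<Longrightarrow> (y, z) \<in> reach F \<Longrightarrow> (x, z) \<in> reach F"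
  unfolding reach_def by (rule rtrancl_trans)

lemma reach_sym: "(x, y) \<in> reach F \<Longrightarrow> (y, x) \<in> reach F"
  unfolding reach_def by (rule symD[OF sym_rtrancl]) (auto simp: sym_def insert_commute)

lemma reach_mono: "F \<subseteq> G \<Longrightarrow> (x, y) \<in> reach F \<Longrightarrow> (x, y) \<in> reach G"
  unfolding reach_def by (rule subsetD[OF rtrancl_mono]) auto

lemma reach_induct [consumes 1, case_names base step]:
  assumes "(s, w) \<in> reach F" "P s"
    and "\<And>y z. (s, y) \<in> reach F \<Longrightarrow> {y, z} \<in> F \<Longrightarrow> P y \<Longrightarrow> P z"
  shows "P w"
  using assms(1) unfolding reach_def
  by (rule rtrancl_induct) (use assms(2,3) in \<open>auto simp: reach_def\<close>)

text \<open>One crossing of the new edge suffices: a second crossing only leads back to an endpoint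
  that is already covered by one of the three cases.\<close>

lemma reach_insertD:
  assumes "(x, y) \<in> reach (insert {a, b} F)"
  shows "(x, y) \<in> reach F \<or> (x, a) \<in> reach F \<and> (b, y) \<in> reach F
    \<or> (x, b) \<in> reach F \<and> (a, y) \<in> reach F"
  using assms
proof (induction rule: reach_induct)
  case base
  show ?case by simp
next
  case (step y z)
  show ?case
  proof (cases "{y, z} \<in> F")
    case True
    then show ?thesis
      using step.IH reach_trans reach_edge by metis
  next
    case False
    then have "y = a \<and> z = b \<or> y = b \<and> z = a"
      using step.hyps by (auto simp: doubleton_eq_iff)
    then show ?thesis using step.IH by auto
  qed
qed

lemma component_edge:
  assumes "{a, b} \<in> F"
  shows "a \<in> component F s \<longleftrightarrow> b \<in> component F s"
  using reach_edge[OF assms] reach_sym reach_trans unfolding component_def mem_Collect_eq by metis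

section \<open>Cycles and bridges\<close>

text \<open>Whenever the walk returns to a vertex of the path, the loop is cut off. The path is
  listed from the end \<open>x\<close> back to \<open>y\<close>, so that each step of the induction
  works at the head of the list.\<close>

lemma distinct_path_exists:
  assumes "(y, x) \<in> reach F"
  shows "\<exists>p. p \<noteq> [] \<and> hd p = x \<and> last p = y \<and> distinct p
    \<and> successively (\<lambda>x y. {x, y} \<in> F) p"
  using assms
proof (induction rule: reach_induct)
  case base
  show ?case by (intro exI[of _ "[y]"]) simp
next
  case (step z x)
  then obtain p where p: "p \<noteq> []" "hd p = z" "last p = y" "distinct p"
    "successively (\<lambda>x y. {x, y} \<in> F) p" by blast
  show ?case
  proof (cases "x \<in> set p")
    case True
    then obtain ps qs where "p = ps @ x # qs" by (meson split_list)
    with p show ?thesis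
      by (intro exI[of _ "x # qs"]) (auto simp: successively_append_iff)
  next
    case False
    with p step.hyps show ?thesis
      by (intro exI[of _ "x # p"]) (auto simp: successively_Cons insert_commute)
  qed
qed

text \<open>A path from \<open>a\<close> to \<open>b\<close> avoiding the edge \<open>{a, b}\<close>
  is closed by this edge. Length 1 would force \<open>a = b\<close>, and length 2 would use the
  removed edge.\<close>

lemma cycle_through_non_bridge:
  assumes "{a, b} \<in> T" "a \<noteq> b" "(a, b) \<in> reach (T - {{a, b}})"
  shows "\<exists>p. graph_cycle T p"
proof -
  obtain p where p: "p \<noteq> []" "hd p = a" "last p = b" "distinct p"
    and succ: "successively (\<lambda>x y. {x, y} \<in> T - {{a, b}}) p"
    using distinct_path_exists[OF reach_sym[OF assms(3)]] by blast
  have edge: "{p ! i, p ! Suc i} \<in> T - {{a, b}}" if "Suc i < length p" for i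
    using succ that by (simp add: successively_conv_nth)
  have ends: "p ! 0 = a" "p ! (length p - 1) = b"
    using p by (simp_all add: hd_conv_nth last_conv_nth)
  have "length p \<noteq> 1"
    using ends assms(2) by auto
  moreover have "length p \<noteq> 2"
    using ends edge[of 0] by auto
  ultimately have len: "3 \<le> length p"
    using p(1) by (cases "length p") auto
  have "{p ! i, p ! (Suc i mod length p)} \<in> T" if i: "i < length p" for i
  proof (cases "Suc i < length p")
    case True
    then show ?thesis using edge by auto
  next
    case False
    then have "i = length p - 1" "Suc i = length p" using i by auto
    then show ?thesis using ends assms(1) by (simp add: insert_commute)
  qed
  then show ?thesis using len p(4) unfolding graph_cycle_def by blast
qed

text \<open>The closing edge of the cycle is not a bridge: the rest of the cycle still joins its
  endpoints.\<close>

lemma graph_cycle_not_all_bridges: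
  assumes "graph_cycle T p"
  shows "\<not> all_bridges T"
proof -
  define n where "n = length p"
  define e where "e = {p ! 0, p ! (n - 1)}"
  have n: "3 \<le> n" and dist: "distinct p"
    and edge: "\<And>i. i < n \<Longrightarrow> {p ! i, p ! (Suc i mod n)} \<in> T"
    using assms unfolding graph_cycle_def n_def by auto
  have "(p ! 0, p ! i) \<in> reach (T - {e})" if "i < n" for i
    using that
  proof (induction i)
    case 0
    show ?case by simp
  next
    case (Suc i)
    have inj: "p ! j = p ! k \<longleftrightarrow> j = k" if "j < n" "k < n" for j k
      using dist that by (simp add: nth_eq_iff_index_eq n_def)
    \<comment> \<open>Equality would force \<open>i = 0\<close> and then \<open>n - 1\<close> to be
      0 or 1, against \<open>3 \<le> n\<close>.\<close>
    have "{p ! i, p ! Suc i} \<noteq> e"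
    proof
      assume eq: "{p ! i, p ! Suc i} = e"
      then have "p ! 0 = p ! i \<or> p ! 0 = p ! Suc i" by (auto simp: e_def)
      then have "i = 0" using Suc.prems inj[of 0 i] inj[of 0 "Suc i"] by simp
      moreover have "p ! (n - 1) = p ! i \<or> p ! (n - 1) = p ! Suc i"
        using eq by (auto simp: e_def)
      ultimately show False
        using Suc.prems n inj[of "n - 1" i] inj[of "n - 1" "Suc i"] by auto
    qed
    then have "{p ! i, p ! Suc i} \<in> T - {e}"
      using edge[of i] Suc.prems by simp
    then show ?case
      using Suc reach_edge reach_trans by (metis Suc_lessD)
  qed
  then have "(p ! 0, p ! (n - 1)) \<in> reach (T - {e})"
    using n by simp
  moreover have "e \<in> T"
    using edge[of "n - 1"] n by (simp add: e_def insert_commute)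
  ultimately show ?thesis
    unfolding all_bridges_def e_def by blast
qed

text \<open>Simplicity of \<open>E\<close> supplies \<open>a \<noteq> b\<close>: a loop lies on no
  \<open>graph_cycle\<close>, yet it is not a bridge in the sense of
  \<open>all_bridges\<close>.\<close>

lemma spanning_tree_iff:
  assumes "simple_graph E"
  shows "spanning_tree E T \<longleftrightarrow> T \<subseteq> E \<and> graph_connected T \<and> all_bridges T"
proof -
  have "(\<nexists>p. graph_cycle T p) \<longleftrightarrow> all_bridges T" if "T \<subseteq> E"
  proof -
    have "a \<noteq> b" if "{a, b} \<in> T" for a b
      using assms that \<open>T \<subseteq> E\<close> by (fastforce simp: simple_graph_def)
    then show ?thesis
      using cycle_through_non_bridge graph_cycle_not_all_bridges
      unfolding all_bridges_def by metis
  qed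
  then show ?thesis unfolding spanning_tree_def by blast
qed

section \<open>Tree paths and telescoping sums\<close>

text \<open>The edges on the path from \<open>s\<close> to \<open>r\<close> in the tree \<open>T\<close>, oriented from \<open>s\<close> to \<open>r\<close>.\<close>

definition path_arcs :: "'v set set \<Rightarrow> 'v \<Rightarrow> 'v \<Rightarrow> ('v \<times> 'v) set" where
  "path_arcs T s r = {(a, b). {a, b} \<in> T \<and> a \<in> component (T - {{a, b}}) s
     \<and> b \<notin> component (T - {{a, b}}) s \<and> r \<notin> component (T - {{a, b}}) s}"

text \<open>Removing a tree edge leaves two components, one around each endpoint, and
  \<open>s\<close> lies in exactly one of them.\<close>

lemma component_bridge:
  assumes "graph_connected T" "all_bridges T" "{a, b} \<in> T"
  shows "a \<in> component (T - {{a, b}}) s \<longleftrightarrow> b \<notin> component (T - {{a, b}}) s"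
proof -
  let ?F = "T - {{a, b}}"
  have "insert {a, b} ?F = T" using assms(3) by blast
  then have "(s, a) \<in> reach (insert {a, b} ?F)"
    using assms(1) by (simp add: graph_connected_iff_reach)
  then have "(s, a) \<in> reach ?F \<or> (s, b) \<in> reach ?F"
    using reach_insertD[of s a a b ?F] by blast
  moreover have "(a, b) \<notin> reach ?F"
    using assms(2,3) by (simp add: all_bridges_def)
  ultimately show ?thesis
    unfolding component_def mem_Collect_eq using reach_sym reach_trans by metis
qed

text \<open>After removal of any other edge, \<open>q\<close> and \<open>r\<close> are still
  adjacent and so on the same side. Hence moving the target from \<open>q\<close> to
  \<open>r\<close> affects only the edge \<open>{q, r}\<close> itself, which \<open>q\<close> meets
  on the side of \<open>s\<close>.\<close>

lemma path_arcs_extend: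
  assumes "graph_connected T" "all_bridges T" "{q, r} \<in> T"
    and q: "q \<in> component (T - {{q, r}}) s"
  shows "path_arcs T s r = insert (q, r) (path_arcs T s q)" "(q, r) \<notin> path_arcs T s q"
proof -
  have r: "r \<notin> component (T - {{q, r}}) s"
    using component_bridge[OF assms(1-3)] q by blast
  have "(a, b) \<in> path_arcs T s r \<longleftrightarrow> (a, b) \<in> insert (q, r) (path_arcs T s q)" for a b
  proof (cases "{a, b} = {q, r}")
    case True
    then have "a = q \<and> b = r \<or> a = r \<and> b = q" by (simp add: doubleton_eq_iff)
    then show ?thesis
      using q r assms(3) by (auto simp: path_arcs_def insert_commute)
  next
    case False
    then have "{q, r} \<in> T - {{a, b}}" using assms(3) by blast
    then show ?thesis
      using component_edge[of q r "T - {{a, b}}" s] False by (auto simp: path_arcs_def)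
  qed
  then show "path_arcs T s r = insert (q, r) (path_arcs T s q)" by auto
  show "(q, r) \<notin> path_arcs T s q" using q by (simp add: path_arcs_def)
qed

text \<open>Induction along an arbitrary walk from \<open>s\<close>: each step either lengthens the
  tree path by one arc or retracts its last arc, and the sum changes by the matching
  difference.\<close>

lemma sum_path_arcs:
  fixes x :: "'v::finite \<Rightarrow> int"
  assumes "graph_connected T" "all_bridges T"
  shows "(\<Sum>(a, b)\<in>path_arcs T s r. x a - x b) = x s - x r"
proof -
  have "(s, r) \<in> reach T" using assms(1) by (simp add: graph_connected_iff_reach)
  then show ?thesis
  proof (induction rule: reach_induct)
    case base
    have "path_arcs T s s = {}" by (auto simp: path_arcs_def component_def)
    then show ?case by simp
  next
    case (step q r)
    then have e: "{q, r} \<in> T" "{r, q} \<in> T" by (auto simp: insert_commute)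
    show ?case
    proof (cases "q \<in> component (T - {{q, r}}) s")
      case True
      show ?thesis
        using path_arcs_extend[OF assms e(1) True] step.IH by simp
    next
      case False
      \<comment> \<open>The walk steps back towards \<open>s\<close>, so the extension lemma applies
        with \<open>q\<close> and \<open>r\<close> exchanged: the arc \<open>(r, q)\<close> is
        dropped.\<close>
      then have "r \<in> component (T - {{r, q}}) s"
        using component_bridge[OF assms e(2)] by (simp add: insert_commute)
      from path_arcs_extend[OF assms e(2) this] step.IH show ?thesis by simp
    qed
  qed
qed

section \<open>Exchanging an edge of a spanning tree\<close>

text \<open>The forest \<open>F\<close> has two components, and any edge of \<open>E\<close> leaving
  that of \<open>s\<close> joins them to a tree again. As \<open>r\<close> lies in the other
  component, the new edge is on the new path from \<open>s\<close> to \<open>r\<close>.\<close>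

lemma tree_exchange:
  assumes "simple_graph E" "spanning_tree E T" "(a, b) \<in> path_arcs T s r"
    and F: "F = T - {{a, b}}"
    and cd: "{c, d} \<in> E" "c \<in> component F s" "d \<notin> component F s"
  shows "spanning_tree E (insert {c, d} F)" "(c, d) \<in> path_arcs (insert {c, d} F) s r"
    "{c, d} \<notin> F"
proof -
  have T: "T \<subseteq> E" "graph_connected T" "all_bridges T"
    using assms(1,2) by (simp_all add: spanning_tree_iff)
  have ab: "{a, b} \<in> T" "a \<in> component F s" "b \<notin> component F s" "r \<notin> component F s"
    using assms(3) by (auto simp: path_arcs_def F)
  have Tins: "T = insert {a, b} F" using ab(1) F by blast
  let ?S = "insert {c, d} F"
  show nF: "{c, d} \<notin> F" using component_edge[of c d F s] cd by blast
  then have SF: "?S - {{c, d}} = F" by blast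
  show "(c, d) \<in> path_arcs ?S s r" using SF cd ab by (simp add: path_arcs_def)
  have sc: "(s, c) \<in> reach F"
    and sb: "(s, b) \<notin> reach F" and sd: "(s, d) \<notin> reach F"
    using cd ab by (simp_all add: component_def)
  have cdF: "(c, d) \<notin> reach F" using sc sd reach_trans by metis
  have FS: "(y, z) \<in> reach F \<Longrightarrow> (y, z) \<in> reach ?S" for y z
    by (rule reach_mono) auto
  \<comment> \<open>Every vertex is in the component of \<open>s\<close> or in that of
    \<open>b\<close>; the latter also contains \<open>d\<close>.\<close>
  have dich: "(s, w) \<in> reach F \<or> (b, w) \<in> reach F" for w
  proof -
    have "(s, w) \<in> reach (insert {a, b} F)"
      using T(2) Tins by (simp add: graph_connected_iff_reach)
    then show ?thesis using reach_insertD sb by metis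
  qed
  have sw: "(s, w) \<in> reach ?S" for w
  proof (cases "(s, w) \<in> reach F")
    case True
    then show ?thesis by (rule FS)
  next
    case False
    then have "(b, w) \<in> reach F" "(b, d) \<in> reach F" using dich sd by blast+
    then have "(d, w) \<in> reach F" using reach_sym reach_trans by metis
    moreover have "(c, d) \<in> reach ?S" by (rule reach_edge) simp
    ultimately show ?thesis using FS sc reach_trans by metis
  qed
  have "graph_connected ?S"
    unfolding graph_connected_iff_reach using sw reach_sym reach_trans by metis
  moreover have "all_bridges ?S"
    unfolding all_bridges_def
  proof (intro allI impI notI)
    fix g h
    assume gh: "{g, h} \<in> ?S" and con: "(g, h) \<in> reach (?S - {{g, h}})"
    show False
    proof (cases "{g, h} = {c, d}")
      case True
      then have "(g, h) \<in> reach F" using con SF by simp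
      moreover have "g = c \<and> h = d \<or> g = d \<and> h = c" using True by (simp add: doubleton_eq_iff)
      ultimately show False using cdF reach_sym by metis
    next
      case False
      then have ghF: "{g, h} \<in> F" using gh by blast
      let ?G = "F - {{g, h}}"
      \<comment> \<open>A detour around \<open>{g, h}\<close> cannot stay inside \<open>F\<close>,
        because \<open>{g, h}\<close> is a bridge of \<open>T\<close>. It therefore crosses
        \<open>{c, d}\<close>, and its two remaining pieces together with \<open>{g, h}\<close>
        would join \<open>c\<close> to \<open>d\<close> inside \<open>F\<close>.\<close>
      have "?S - {{g, h}} = insert {c, d} ?G" using False by blast
      then have "(g, h) \<in> reach (insert {c, d} ?G)" using con by simp
      moreover have "(g, h) \<notin> reach ?G"
      proof -
        have "(g, h) \<notin> reach (T - {{g, h}})"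
          using T(3) ghF Tins by (simp add: all_bridges_def)
        moreover have "?G \<subseteq> T - {{g, h}}" using Tins by blast
        ultimately show ?thesis using reach_mono by metis
      qed
      ultimately have "(g, c) \<in> reach ?G \<and> (d, h) \<in> reach ?G
          \<or> (g, d) \<in> reach ?G \<and> (c, h) \<in> reach ?G"
        using reach_insertD by metis
      moreover have "(y, z) \<in> reach ?G \<Longrightarrow> (y, z) \<in> reach F" for y z
        by (rule reach_mono) auto
      ultimately have "(g, c) \<in> reach F \<and> (d, h) \<in> reach F
          \<or> (g, d) \<in> reach F \<and> (c, h) \<in> reach F" by blast
      moreover have "(g, h) \<in> reach F" using ghF by (rule reach_edge)
      ultimately have "(c, d) \<in> reach F"
        using reach_sym reach_trans by metis
      then show False using cdF by simp
    qed
  qed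
  moreover have "?S \<subseteq> E" using T(1) F cd(1) by blast
  ultimately show "spanning_tree E ?S" using assms(1) by (simp add: spanning_tree_iff)
qed

section \<open>Double counting over spanning trees\<close>

text \<open>The Laplacian acting on integer functions, where divisibility makes sense.\<close>

definition int_laplacian :: "'v::finite set set \<Rightarrow> ('v \<Rightarrow> int) \<Rightarrow> 'v \<Rightarrow> int" where
  "int_laplacian E x a = (\<Sum>b | {a, b} \<in> E. x a - x b)"

text \<open>Pairs with both ends in \<open>C\<close> cancel: swapping the ends negates the
  summand.\<close>

lemma sum_int_laplacian:
  fixes x :: "'v::finite \<Rightarrow> int"
  shows "(\<Sum>a\<in>C. int_laplacian E x a)
    = (\<Sum>(a, b) | {a, b} \<in> E \<and> a \<in> C \<and> b \<notin> C. x a - x b)"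
proof -
  let ?I = "{(a, b). {a, b} \<in> E \<and> a \<in> C \<and> b \<in> C}"
  let ?O = "{(a, b). {a, b} \<in> E \<and> a \<in> C \<and> b \<notin> C}"
  have "(\<Sum>(a, b)\<in>?I. x a - x b) = (\<Sum>(a, b)\<in>?I. x b - x a)"
    by (rule sum.reindex_bij_witness[of _ prod.swap prod.swap]) (auto simp: insert_commute)
  also have "\<dots> = - (\<Sum>(a, b)\<in>?I. x a - x b)"
    by (simp add: sum_negf[symmetric] case_prod_unfold)
  finally have I: "(\<Sum>(a, b)\<in>?I. x a - x b) = 0" by simp
  have "(\<Sum>a\<in>C. int_laplacian E x a)
      = (\<Sum>(a, b)\<in>(SIGMA a:C. {b. {a, b} \<in> E}). x a - x b)"
    unfolding int_laplacian_def by (rule sum.Sigma) simp_all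
  also have "(SIGMA a:C. {b. {a, b} \<in> E}) = ?I \<union> ?O" by auto
  also have "(\<Sum>(a, b)\<in>?I \<union> ?O. x a - x b)
      = (\<Sum>(a, b)\<in>?I. x a - x b) + (\<Sum>(a, b)\<in>?O. x a - x b)"
    by (rule sum.union_disjoint) auto
  finally show ?thesis using I by simp
qed

text \<open>Telescoping in each tree gives the left side. Regrouping by forests turns path arcs into
  all arcs leaving the component of \<open>s\<close>. The family \<open>\<F>\<close> stays
  existential, since for divisibility only the values of the Laplacian matter.\<close>

lemma spanning_trees_mult_difference:
  fixes x :: "'v::finite \<Rightarrow> int"
  assumes "simple_graph E"
  shows "\<exists>\<F>. int (num_spanning_trees E) * (x s - x r)
    = (\<Sum>F\<in>\<F>. \<Sum>a\<in>component F s. int_laplacian E x a)"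
proof
  let ?\<T> = "{T. spanning_tree E T}"
  let ?\<F> = "{T - {{a, b}} | T a b. spanning_tree E T \<and> (a, b) \<in> path_arcs T s r}"
  let ?cut = "\<lambda>F. {(a, b). {a, b} \<in> E \<and> a \<in> component F s \<and> b \<notin> component F s}"
  have "int (num_spanning_trees E) * (x s - x r)
      = (\<Sum>T\<in>?\<T>. \<Sum>(a, b)\<in>path_arcs T s r. x a - x b)"
    using assms by (simp add: num_spanning_trees_def spanning_tree_iff sum_path_arcs)
  also have "\<dots> = (\<Sum>(T, a, b)\<in>(SIGMA T:?\<T>. path_arcs T s r). x a - x b)"
    by (subst sum.Sigma) (simp_all add: case_prod_unfold)
  also have "\<dots> = (\<Sum>(F, a, b)\<in>(SIGMA F:?\<F>. ?cut F). x a - x b)"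
  \<comment> \<open>Deleting the arc's edge from the tree and adding it to the forest are mutually
    inverse. By the exchange lemma, every arc in the cut of a forest arises in this way.\<close>
  proof (rule sum.reindex_bij_witness[of _ "\<lambda>(F, a, b). (insert {a, b} F, a, b)"
        "\<lambda>(T, a, b). (T - {{a, b}}, a, b)"], goal_cases)
    case (1 t)
    then show ?case by (auto simp: path_arcs_def)
  next
    case (2 t)
    obtain T a b where t: "t = (T, a, b)" by (cases t)
    then have h: "spanning_tree E T" "(a, b) \<in> path_arcs T s r" using 2 by auto
    then have "(a, b) \<in> ?cut (T - {{a, b}})"
      by (auto simp: path_arcs_def spanning_tree_def)
    moreover have "T - {{a, b}} \<in> ?\<F>" using h by blast
    ultimately show ?case by (simp only: t prod.case mem_Sigma_iff)
  next
    case (3 t)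
    obtain F c d where t: "t = (F, c, d)" by (cases t)
    then have "F \<in> ?\<F>" and cd: "{c, d} \<in> E" "c \<in> component F s" "d \<notin> component F s"
      using 3 by (simp_all only: mem_Sigma_iff) simp_all
    then obtain T a b where h: "spanning_tree E T" "(a, b) \<in> path_arcs T s r" "F = T - {{a, b}}"
      by blast
    show ?case
      using tree_exchange(3)[OF assms h cd] t by simp
  next
    case (4 t)
    obtain F c d where t: "t = (F, c, d)" by (cases t)
    then have "F \<in> ?\<F>" and cd: "{c, d} \<in> E" "c \<in> component F s" "d \<notin> component F s"
      using 4 by (simp_all only: mem_Sigma_iff) simp_all
    then obtain T a b where h: "spanning_tree E T" "(a, b) \<in> path_arcs T s r" "F = T - {{a, b}}"
      by blast
    show ?case
      using tree_exchange(1,2)[OF assms h cd] t by simp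
  next
    case (5 t)
    then show ?case by auto
  qed
  also have "\<dots> = (\<Sum>F\<in>?\<F>. \<Sum>(a, b)\<in>?cut F. x a - x b)"
    by (subst sum.Sigma) (simp_all add: case_prod_unfold)
  also have "\<dots> = (\<Sum>F\<in>?\<F>. \<Sum>a\<in>component F s. int_laplacian E x a)"
    by (simp add: sum_int_laplacian)
  finally show "int (num_spanning_trees E) * (x s - x r)
    = (\<Sum>F\<in>?\<F>. \<Sum>a\<in>component F s. int_laplacian E x a)" .
qed

corollary int_laplacian_kernel_mod_prime:
  fixes x :: "'v::finite \<Rightarrow> int" and p :: int
  assumes "simple_graph E" "prime p" "\<not> p dvd int (num_spanning_trees E)"
    and "\<And>a. p dvd int_laplacian E x a"
  shows "p dvd x s - x r"
proof -
  obtain \<F> where "int (num_spanning_trees E) * (x s - x r)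
    = (\<Sum>F\<in>\<F>. \<Sum>a\<in>component F s. int_laplacian E x a)"
    using spanning_trees_mult_difference[OF assms(1)] by blast
  then have "p dvd int (num_spanning_trees E) * (x s - x r)"
    using assms(4) by (simp add: dvd_sum)
  then show ?thesis using assms(2,3) prime_dvd_mult_iff by blast
qed

section \<open>The real Laplacian matrix and its eigenvectors\<close>

lemma vertex_degree_eq_card_neighbours:
  assumes "simple_graph E"
  shows "vertex_degree E a = card {b. {a, b} \<in> E}"
proof -
  have "bij_betw (\<lambda>b. {a, b}) {b. {a, b} \<in> E} {e \<in> E. a \<in> e}"
  proof (rule bij_betwI')
    fix e assume e: "e \<in> {e \<in> E. a \<in> e}"
    then have "card e = 2" using assms by (simp add: simple_graph_def)
    then obtain c d where "e = {c, d}" by (meson card_2_iff)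
    then have "e = {a, c} \<or> e = {a, d}" using e by auto
    then show "\<exists>b\<in>{b. {a, b} \<in> E}. e = {a, b}" using e by blast
  qed (auto simp: doubleton_eq_iff)
  then show ?thesis by (simp add: vertex_degree_def bij_betw_same_card)
qed

lemma laplacian_matrix_mult_nth:
  assumes "simple_graph E"
  shows "(laplacian_matrix E *v x) $ a = (\<Sum>b | {a, b} \<in> E. x $ a - x $ b)"
proof -
  have "(laplacian_matrix E *v x) $ a
      = (\<Sum>b\<in>UNIV. (if a = b then real (vertex_degree E a) * x $ b else 0))
        - (\<Sum>b\<in>UNIV. if {a, b} \<in> E then x $ b else 0)"
    unfolding laplacian_matrix_def degree_matrix_def adjacency_matrix_def matrix_vector_mult_def
    by (simp add: sum_subtractf left_diff_distrib if_distrib[of "\<lambda>c. c * _"] cong: if_cong)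
  also have "\<dots> = real (vertex_degree E a) * x $ a - (\<Sum>b | {a, b} \<in> E. x $ b)"
    by (simp add: sum.If_cases)
  also have "\<dots> = (\<Sum>b | {a, b} \<in> E. x $ a - x $ b)"
    by (simp add: sum_subtractf vertex_degree_eq_card_neighbours[OF assms])
  finally show ?thesis .
qed

text \<open>Where \<open>x\<close> has an entry \<open>x $ i\<close> of largest absolute value, each
  product \<open>x $ i * (x $ i - x $ b)\<close> is nonnegative; summed over the neighbours these
  give \<open>\<theta> * (x $ i)\<^sup>2\<close>.\<close>

lemma laplacian_eigenvalue_nonneg:
  assumes "simple_graph E" "laplacian_eigenvalue E \<theta>"
  shows "0 \<le> \<theta>"
proof -
  obtain x where x: "x \<noteq> 0" "laplacian_matrix E *v x = \<theta> *\<^sub>R x"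
    using assms(2) by (auto simp: laplacian_eigenvalue_def)
  have "Max (range (\<lambda>j. \<bar>x $ j\<bar>)) \<in> range (\<lambda>j. \<bar>x $ j\<bar>)"
    by (rule Max_in) simp_all
  then obtain i where "Max (range (\<lambda>j. \<bar>x $ j\<bar>)) = \<bar>x $ i\<bar>" by blast
  then have i: "\<bar>x $ j\<bar> \<le> \<bar>x $ i\<bar>" for j
    by (metis Max_ge finite finite_imageI rangeI)
  have xi: "x $ i \<noteq> 0"
    using x(1) i by (metis abs_le_zero_iff abs_zero vec_eq_iff zero_index)
  have "x $ i * x $ b \<le> x $ i * x $ i" for b
  proof -
    have "x $ i * x $ b \<le> \<bar>x $ i\<bar> * \<bar>x $ b\<bar>" by (metis abs_ge_self abs_mult)
    also have "\<dots> \<le> \<bar>x $ i\<bar> * \<bar>x $ i\<bar>" by (rule mult_left_mono[OF i]) simp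
    finally show ?thesis by simp
  qed
  then have "0 \<le> (\<Sum>b | {i, b} \<in> E. x $ i * (x $ i - x $ b))"
    by (intro sum_nonneg) (simp add: right_diff_distrib)
  also have "\<dots> = x $ i * (laplacian_matrix E *v x) $ i"
    by (simp add: laplacian_matrix_mult_nth[OF assms(1)] sum_distrib_left)
  also have "\<dots> = \<theta> * (x $ i)\<^sup>2" by (simp add: x(2) power2_eq_square)
  finally show ?thesis using xi by (simp add: zero_le_mult_iff)
qed

text \<open>The inner product of \<open>x\<close> with the projection of \<open>axis w 1\<close>
  equals its inner product with \<open>axis w 1\<close>, namely \<open>x $ w\<close>. So the
  relation between the projections passes to the entries of every eigenvector.\<close>

lemma eigenvector_antisymmetric:
  assumes "\<theta> \<in> eigenvalue_support_minus E u v" "x \<in> laplacian_eigenspace E \<theta>"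
  shows "x $ u = - x $ v"
proof -
  let ?S = "laplacian_eigenspace E \<theta>"
  have "orthogonal (axis w 1 - laplacian_proj E \<theta> (axis w 1)) x" for w
    using theI'[OF orthogonal_projection_unique[OF subspace_laplacian_eigenspace[of E \<theta>], of "axis w 1"]]
      assms(2) unfolding laplacian_proj_def orthogonal_projection_def by blast
  then have "laplacian_proj E \<theta> (axis w 1) \<bullet> x = x $ w" for w
    by (simp add: orthogonal_def inner_diff_left inner_axis')
  then show ?thesis
    using assms(1) by (metis (mono_tags, lifting) eigenvalue_support_minus_def inner_minus_left mem_Collect_eq)
qed

section \<open>Rational and primitive integer eigenvectors\<close>

text \<open>Lets singularity descend from the reals to the rationals.\<close>

lemma of_rat_det:
  fixes A :: "rat^'n^'n"
  shows "of_rat (det A) = (det (\<chi> i j. of_rat (A $ i $ j)) :: real)"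
  by (simp add: det_def of_rat_sum of_rat_mult of_rat_prod)

lemma det_zero_iff_kernel:
  fixes A :: "'a::field^'n^'n"
  shows "det A = 0 \<longleftrightarrow> (\<exists>x. x \<noteq> 0 \<and> A *v x = 0)"
  using invertible_det_nz[of A] matrix_left_invertible_ker[of A] invertible_left_inverse[of A]
  by blast

text \<open>Multiply by the product \<open>d\<close> of all denominators, then divide by the gcd
  \<open>g\<close> of the resulting integers.\<close>

lemma primitive_int_multiple:
  fixes x :: "rat^'n"
  assumes "x \<noteq> 0"
  obtains y :: "'n \<Rightarrow> int" and c :: rat
  where "\<forall>i. of_int (y i) = c * x $ i" "\<forall>p. prime p \<longrightarrow> (\<exists>i. \<not> p dvd y i)"
proof -
  define d where "d = (\<Prod>i\<in>UNIV. snd (quotient_of (x $ i)))"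
  have d: "d \<noteq> 0"
    unfolding d_def using quotient_of_denom_pos' by (simp add: less_imp_neq[symmetric])
  have "\<exists>z. of_int z = of_int d * x $ i" for i
  proof -
    obtain a b where q: "quotient_of (x $ i) = (a, b)" by fastforce
    have "b dvd d" unfolding d_def using q by (metis dvd_prodI finite UNIV_I snd_conv)
    then obtain k where "d = b * k" by blast
    moreover have "b \<noteq> 0" using quotient_of_denom_pos[OF q] by simp
    ultimately have "of_int (k * a) = of_int d * x $ i"
      using quotient_of_div[OF q] by simp
    then show ?thesis by blast
  qed
  then obtain z where z: "\<And>i. of_int (z i) = of_int d * x $ i" by metis
  define g where "g = Gcd (range z)"
  obtain j where "x $ j \<noteq> 0" using assms by (metis vec_eq_iff zero_index)
  then have "z j \<noteq> 0" using z[of j] d by auto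
  then have g: "g \<noteq> 0" unfolding g_def by auto
  have "\<forall>i. \<exists>k. z i = g * k" unfolding g_def by (meson Gcd_dvd dvdE rangeI)
  then obtain y where y: "\<And>i. z i = g * y i" by metis
  show thesis
  proof (rule that; intro allI impI)
    fix i
    have "of_int g * of_int (y i) = of_int d * x $ i"
      using z[of i] y[of i] by simp
    then show "of_int (y i) = (of_int d / of_int g) * x $ i"
      using g by (simp add: field_simps)
  next
    fix p :: int
    assume p: "prime p"
    show "\<exists>i. \<not> p dvd y i"
    proof (rule ccontr)
      assume "\<nexists>i. \<not> p dvd y i"
      \<comment> \<open>A common prime factor of the quotients would make \<open>g * p\<close> a
        common divisor of all \<open>z i\<close>, hence a divisor of their gcd
        \<open>g\<close>.\<close>
      then have "g * p dvd z i" for i using y by simp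
      then have "g * p dvd g" unfolding g_def by (intro Gcd_greatest) auto
      then show False using g p by (metis dvd_mult_cancel_left mult.right_neutral not_prime_unit)
    qed
  qed
qed

lemma int_laplacian_eigenvector:
  fixes E :: "'v::finite set set" and m :: int
  assumes "simple_graph E" "laplacian_eigenvalue E (of_int m)"
  obtains y where "(\<chi> i. of_int (y i)) \<in> laplacian_eigenspace E (of_int m)"
    "\<And>a. int_laplacian E y a = m * y a" "\<And>p. prime p \<Longrightarrow> \<exists>i. \<not> p dvd y i"
proof -
  \<comment> \<open>\<open>A\<close> is the Laplacian minus \<open>m\<close> times the identity over
    the rationals, and \<open>B\<close> is its real image. The real eigenvector makes
    \<open>det B\<close>, hence \<open>det A\<close>, vanish, which yields a rational
    eigenvector.\<close>
  define A :: "rat^'v^'v" where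
    "A = (\<chi> i j. (if i = j then of_nat (vertex_degree E i) - of_int m else 0)
                  - (if {i, j} \<in> E then 1 else 0))"
  define B where "B = (\<chi> i j. real_of_rat (A $ i $ j))"
  have "B = laplacian_matrix E - of_int m *\<^sub>R mat 1"
    unfolding B_def A_def laplacian_matrix_def degree_matrix_def adjacency_matrix_def mat_def
    by (auto simp: vec_eq_iff of_rat_diff)
  then have B: "B *v x = laplacian_matrix E *v x - of_int m *\<^sub>R x" for x
    by (simp add: matrix_vector_mult_diff_rdistrib scaleR_matrix_vector_assoc[symmetric])
  have "\<exists>x. x \<noteq> 0 \<and> B *v x = 0"
    using assms(2) by (auto simp: laplacian_eigenvalue_def B)
  then have "det B = 0" by (simp add: det_zero_iff_kernel)
  then have "det A = 0" using of_rat_det[of A] by (simp add: B_def)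
  then obtain x where x: "x \<noteq> 0" "A *v x = 0" by (auto simp: det_zero_iff_kernel)
  obtain y c where y: "\<forall>i. of_int (y i) = c * x $ i"
    and prim: "\<forall>p. prime p \<longrightarrow> (\<exists>i. \<not> p dvd y i)"
    by (rule primitive_int_multiple[OF x(1)])
  let ?y = "(\<chi> i. of_int (y i)) :: real^'v"
  have yr: "real_of_int (y i) = of_rat (c * x $ i)" for i
    using arg_cong[OF y[rule_format, of i], of "of_rat :: rat \<Rightarrow> real"] by simp
  have "(B *v ?y) $ i = of_rat (c * (A *v x) $ i)" for i
    unfolding matrix_vector_mult_def B_def
    by (simp add: yr of_rat_mult of_rat_sum sum_distrib_left mult_ac)
  then have "B *v ?y = 0" by (simp add: x(2) vec_eq_iff)
  then have ev: "laplacian_matrix E *v ?y = of_int m *\<^sub>R ?y" by (simp add: B)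
  have "real_of_int (int_laplacian E y a) = of_int (m * y a)" for a
    using arg_cong[OF ev, of "\<lambda>w. w $ a"]
    by (simp add: laplacian_matrix_mult_nth[OF assms(1)] int_laplacian_def)
  then have "int_laplacian E y a = m * y a" for a by (metis of_int_eq_iff)
  then show thesis using that ev prim by (simp add: laplacian_eigenspace_def)
qed

section \<open>Excluding odd prime divisors of the eigenvalue\<close>

lemma power_of_two_if_no_odd_prime_divisor:
  fixes n :: nat
  assumes "n \<noteq> 0" "\<And>p. prime p \<Longrightarrow> p dvd n \<Longrightarrow> p = 2"
  shows "\<exists>k. n = 2 ^ k"
proof -
  obtain m where m: "n = 2 ^ multiplicity 2 n * m" "\<not> 2 dvd m"
    using multiplicity_decompose'[of n 2] assms(1) by auto
  have "m = 1"
  proof (rule ccontr)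
    assume "m \<noteq> 1"
    then obtain p where "prime p" "p dvd m" using prime_factor_nat by blast
    then show False using assms(2)[of p] m by (metis dvd_mult)
  qed
  then show ?thesis using m(1) by auto
qed

theorem theorem7:
  fixes E :: "'v::finite set set" and u v :: 'v and \<theta> :: real
  assumes "simple_graph E"
    and "\<exists>k::nat. num_spanning_trees E = 2 ^ k"
    and "laplacian_eigenvalue E \<theta>" and "\<theta> \<in> \<int>" and "\<theta> \<noteq> 0"
    and "\<theta> \<in> eigenvalue_support_minus E u v"
  shows "\<exists>k::nat. \<theta> = 2 ^ k"
proof -
  obtain m where "\<theta> = of_int m" using assms(4) by (auto elim: Ints_cases)
  then obtain n where n: "\<theta> = of_int (int n)" "n \<noteq> 0"
    using laplacian_eigenvalue_nonneg[OF assms(1,3)] assms(5)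
    by (metis of_int_0 of_int_0_le_iff of_nat_0 zero_le_imp_eq_int)
  obtain y where y: "(\<chi> i. of_int (y i)) \<in> laplacian_eigenspace E \<theta>"
      "\<And>a. int_laplacian E y a = int n * y a" "\<And>p. prime p \<Longrightarrow> \<exists>i. \<not> p dvd y i"
    using int_laplacian_eigenvector[OF assms(1)] assms(3) unfolding n(1) by metis
  have "real_of_int (y u + y v) = 0"
    using eigenvector_antisymmetric[OF assms(6) y(1)] by simp
  then have uv: "y u + y v = 0" by (simp only: of_int_eq_0_iff)
  have "p = 2" if p: "prime p" "p dvd n" for p
  proof (rule ccontr)
    assume "p \<noteq> 2"
    obtain k where k: "num_spanning_trees E = 2 ^ k" using assms(2) by blast
    have p2: "\<not> p dvd 2" using p(1) \<open>p \<noteq> 2\<close> primes_dvd_imp_eq two_is_prime_nat by blast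
    then have "\<not> p dvd num_spanning_trees E"
      using p(1) prime_dvd_power k by metis
    then have "\<not> int p dvd int (num_spanning_trees E)" by simp
    moreover have pp: "prime (int p)" using p(1) by simp
    \<comment> \<open>As \<open>p\<close> divides the eigenvalue \<open>n\<close>, the eigenvector
      \<open>y\<close> lies in the kernel of the Laplacian modulo \<open>p\<close>.\<close>
    moreover have "int p dvd int_laplacian E y a" for a using p(2) y(2) by simp
    ultimately have const: "int p dvd y s - y r" for s r
      using int_laplacian_kernel_mod_prime[OF assms(1)] by blast
    obtain i where i: "\<not> int p dvd y i" using y(3) pp by blast
    \<comment> \<open>Adding the two differences eliminates \<open>y u\<close> and
      \<open>y v\<close>, whose sum is zero, and leaves \<open>2 * y i\<close>, where
      \<open>p\<close> divides neither factor.\<close>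
    have "int p dvd (y i - y u) + (y i - y v)" using const dvd_add by blast
    also have "(y i - y u) + (y i - y v) = 2 * y i" using uv by simp
    finally have "int p dvd 2" using pp i prime_dvd_mult_iff by blast
    then show False using p2 by (metis int_dvd_int_iff of_nat_numeral)
  qed
  then obtain k where "n = 2 ^ k" using power_of_two_if_no_odd_prime_divisor n(2) by blast
  then show ?thesis using n(1) by auto
qed

end
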